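(* Let $d\ge1$ and let $P\subset\mathbb{R}^d$ be an integral generic orthotope of dimension $d$. Then $$\mathrm{volume}(P)=2^{-d}\sum_{v\in P\cap\mathbb{Z}^d}\mu_d(\alpha(v)),$$ where $\alpha(v)$ denotes the tangent cone of $P$ at $v$ and $\mu_d(\alpha(v))$ is the number of orthants of $\mathbb{R}^d$ contained in $\alpha(v)$.
   Context: **Floral vertices.** A series-parallel diagram (SPD) $\Delta$ with finite nonempty edge set $E$ is either a single edge, or a series connection $\Delta_1\wedge\Delta_2$, or a parallel connection $\Delta_1\vee\Delta_2$, of SPDs with disjoint nonempty edge sets whose union is $E$ (a read-once formula in $\wedge,\vee$). A signed SPD is a pair $(\Delta,s)$ with $s:E\to\{\pm1\}$. Let $H_i=\{x\in\mathbb{R}^d: x_i\ge 0\}$. If $E=\{1,\dots,d\}$, the floral vertex in $\mathbb{R}^d$ determined by $(\Delta,s)$ is the set obtained by interpreting edge $i$ as $s_iH_i$, series connection as intersection and parallel connection as union. **Orthogonal polytopes.** An axis-aligned box is a product $\prod_{i=1}^d[a_i,b_i]$, $a_i\le b_i$; it is pure $d$-dimensional if all $a_i<b_i$. An orthogonal polytope is a finite (possibly empty) union of boxes, pure $d$-dimensional if the boxes can be taken pure $d$-dimensional. It is integral if it is a finite union of sets $v+f_v$ with $v\in\mathbb{Z}^d$ and $f_v$ a face of the unit cube $[0,1]^d$. For $s\in\{\pm1\}^d$ the orthant $\Omega_s$ is $\{x: s_ix_i\ge0\ \forall i\}$; a local orthotopal arrangement is a union of orthants. For $P$ pure $d$-dimensional,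 the tangent cone of $P$ at $v\in P$ is the local orthotopal arrangement $\alpha$ such that for some $\delta>0$, $P\cap(v+[-\delta,\delta]^d)=v+(\alpha\cap[-\delta,\delta]^d)$. The genericity region of $v\in P$ is the set of points of $P$ joined to $v$ by a path in $P$ along which every tangent cone is congruent (under signed coordinate permutations) to the one at $v$. Its degree is the smallest dimension of a set of the form $\{x:x_i=\lambda_i\ \forall i\in I\}$ ($I\subset\{1,\dots,d\}$) containing it. A point is singular (a vertex of $P$) if its genericity region has degree $0$. **Generic orthotope.** A generic orthotope of dimension $d$ is a pure $d$-dimensional orthogonal polytope in $\mathbb{R}^d$ such that the tangent cone at every singular point is a floral vertex in $\mathbb{R}^d$. *)

theory Defs
  imports "HOL-Analysis.Analysis"
begin

text \<open>The ambient space is \<open>real ^ 'n\<close>, with \<open>d = CARD('n) \<ge> 1\<close>; coordinates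
  (and hence the edges of the diagrams of floral vertices) are indexed by the elements of \<open>'n\<close>.\<close>

section \<open>Floral vertices\<close>

datatype 'a formula =
    Edge 'a
  | Series "'a formula" "'a formula"
  | Parallel "'a formula" "'a formula"

fun edges :: "'a formula \<Rightarrow> 'a set" where
  "edges (Edge e) = {e}"
| "edges (Series D1 D2) = edges D1 \<union> edges D2"
| "edges (Parallel D1 D2) = edges D1 \<union> edges D2"

text \<open>A series-parallel diagram is a read-once formula.\<close>

fun spd :: "'a formula \<Rightarrow> bool" where
  "spd (Edge e) \<longleftrightarrow> True"
| "spd (Series D1 D2) \<longleftrightarrow> spd D1 \<and> spd D2 \<and> edges D1 \<inter> edges D2 = {}"
| "spd (Parallel D1 D2) \<longleftrightarrow> spd D1 \<and> spd D2 \<and> edges D1 \<inter> edges D2 = {}"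

definition sign_function :: "('a \<Rightarrow> real) \<Rightarrow> bool" where
  "sign_function s \<longleftrightarrow> (\<forall>i. s i = 1 \<or> s i = -1)"

definition coord_halfspace :: "'n \<Rightarrow> (real ^ 'n) set" where
  "coord_halfspace i = {x. x $ i \<ge> 0}"

fun realize :: "('n \<Rightarrow> real) \<Rightarrow> 'n formula \<Rightarrow> (real ^ 'n) set" where
  "realize s (Edge i) = (\<lambda>x. s i *\<^sub>R x) ` coord_halfspace i"
| "realize s (Series D1 D2) = realize s D1 \<inter> realize s D2"
| "realize s (Parallel D1 D2) = realize s D1 \<union> realize s D2"

definition floral_vertex :: "(real ^ 'n) set \<Rightarrow> bool" where
  "floral_vertex A \<longleftrightarrow>
     (\<exists>D s. spd D \<and> edges D = UNIV \<and> sign_function s \<and> A = realize s D)"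

section \<open>Orthogonal polytopes\<close>

definition pure_box :: "(real ^ 'n) set \<Rightarrow> bool" where
  "pure_box B \<longleftrightarrow> (\<exists>a b. (\<forall>i. a $ i < b $ i) \<and> B = {x. \<forall>i. a $ i \<le> x $ i \<and> x $ i \<le> b $ i})"

text \<open>Pure \<open>d\<close>-dimensional orthogonal polytopes; the empty set is included.\<close>

definition pure_orthogonal_polytope :: "(real ^ 'n) set \<Rightarrow> bool" where
  "pure_orthogonal_polytope P \<longleftrightarrow> (\<exists>F. finite F \<and> (\<forall>B\<in>F. pure_box B) \<and> P = \<Union>F)"

definition integer_points :: "(real ^ 'n) set" where
  "integer_points = {v. \<forall>i. v $ i \<in> \<int>}"

definition integral_polytope :: "(real ^ 'n) set \<Rightarrow> bool" where
  "integral_polytope P \<longleftrightarrow>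
     (\<exists>F. finite F \<and>
        (\<forall>B\<in>F. \<exists>v f. v \<in> integer_points \<and> f face_of cbox 0 1 \<and> B = (\<lambda>x. v + x) ` f) \<and>
        P = \<Union>F)"

section \<open>Tangent cones\<close>

definition orthant :: "('n \<Rightarrow> real) \<Rightarrow> (real ^ 'n) set" where
  "orthant s = {x. \<forall>i. s i * x $ i \<ge> 0}"

definition orthants :: "(real ^ 'n) set set" where
  "orthants = orthant ` {s. sign_function s}"

definition local_arrangement :: "(real ^ 'n) set \<Rightarrow> bool" where
  "local_arrangement A \<longleftrightarrow> (\<exists>\<O>\<subseteq>orthants. A = \<Union>\<O>)"

definition cube :: "real \<Rightarrow> (real ^ 'n) set" where
  "cube \<delta> = {x. \<forall>i. -\<delta> \<le> x $ i \<and> x $ i \<le> \<delta>}"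

definition is_tangent_cone :: "(real ^ 'n) set \<Rightarrow> real ^ 'n \<Rightarrow> (real ^ 'n) set \<Rightarrow> bool" where
  "is_tangent_cone P v A \<longleftrightarrow> local_arrangement A \<and>
     (\<exists>\<delta>>0. P \<inter> (\<lambda>x. v + x) ` cube \<delta> = (\<lambda>x. v + x) ` (A \<inter> cube \<delta>))"

text \<open>Well defined when \<open>P\<close> is a pure orthogonal polytope; see \<open>tangent_cone\<close> below.\<close>

definition tangent_cone :: "(real ^ 'n) set \<Rightarrow> real ^ 'n \<Rightarrow> (real ^ 'n) set" where
  "tangent_cone P v = (THE A. is_tangent_cone P v A)"

definition mu :: "(real ^ 'n) set \<Rightarrow> nat" where
  "mu A = card {Q \<in> orthants. Q \<subseteq> A}"

section \<open>Generic orthotopes\<close>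

definition signed_permutation :: "(real ^ 'n \<Rightarrow> real ^ 'n) \<Rightarrow> bool" where
  "signed_permutation g \<longleftrightarrow>
     (\<exists>p s. bij p \<and> sign_function s \<and> g = (\<lambda>x. \<chi> i. s i * x $ p i))"

definition congruent_cones :: "(real ^ 'n) set \<Rightarrow> (real ^ 'n) set \<Rightarrow> bool" where
  "congruent_cones A B \<longleftrightarrow> (\<exists>g. signed_permutation g \<and> g ` A = B)"

definition genericity_region :: "(real ^ 'n) set \<Rightarrow> real ^ 'n \<Rightarrow> (real ^ 'n) set" where
  "genericity_region P v =
     {w. \<exists>\<gamma>. path \<gamma> \<and> pathstart \<gamma> = v \<and> pathfinish \<gamma> = w \<and> path_image \<gamma> \<subseteq> P \<and>
           (\<forall>x\<in>path_image \<gamma>. congruent_cones (tangent_cone P x) (tangent_cone P v))}"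

definition coord_flat :: "'n set \<Rightarrow> ('n \<Rightarrow> real) \<Rightarrow> (real ^ 'n) set" where
  "coord_flat I c = {x. \<forall>i\<in>I. x $ i = c i}"

text \<open>Coordinate flats are nonempty, so their \<open>int\<close>-valued \<open>aff_dim\<close> is nonnegative.\<close>

definition genericity_degree :: "(real ^ 'n) set \<Rightarrow> real ^ 'n \<Rightarrow> nat" where
  "genericity_degree P v =
     (LEAST k. \<exists>I c. genericity_region P v \<subseteq> coord_flat I c \<and> aff_dim (coord_flat I c) = int k)"

definition singular_point :: "(real ^ 'n) set \<Rightarrow> real ^ 'n \<Rightarrow> bool" where
  "singular_point P v \<longleftrightarrow> v \<in> P \<and> genericity_degree P v = 0"

definition generic_orthotope :: "(real ^ 'n) set \<Rightarrow> bool" where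
  "generic_orthotope P \<longleftrightarrow> pure_orthogonal_polytope P \<and>
     (\<forall>v. singular_point P v \<longrightarrow> floral_vertex (tangent_cone P v))"

section \<open>Existence and uniqueness of tangent cones\<close>

lemma orthant_scale_iff:
  assumes "t > 0"
  shows "t *\<^sub>R x \<in> orthant s \<longleftrightarrow> x \<in> orthant s"
proof -
  have "s i * (t * x $ i) \<ge> 0 \<longleftrightarrow> s i * x $ i \<ge> 0" for i
    using assms by (metis linorder_not_le mult.left_commute mult_nonneg_nonneg mult_pos_neg
        order_less_imp_le)
  then show ?thesis by (simp add: orthant_def)
qed

lemma local_arrangement_scale_iff:
  assumes "local_arrangement A" "t > 0"
  shows "t *\<^sub>R x \<in> A \<longleftrightarrow> x \<in> A"
proof -
  obtain O' where O': "O' \<subseteq> orthants" "A = \<Union>O'"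
    using assms(1) by (auto simp: local_arrangement_def)
  have "t *\<^sub>R x \<in> Q \<longleftrightarrow> x \<in> Q" if "Q \<in> O'" for Q
    using that O'(1) orthant_scale_iff[OF assms(2)] by (auto simp: orthants_def)
  then show ?thesis using O'(2) by auto
qed

lemma scale_in_cube:
  fixes x :: "real ^ 'n"
  assumes "\<delta> > 0"
  obtains t where "t > 0" "t *\<^sub>R x \<in> cube \<delta>"
proof
  define t where "t = \<delta> / (norm x + 1)"
  have n: "norm x + 1 > 0" using norm_ge_zero[of x] by linarith
  show t: "t > 0" using assms n by (simp add: t_def)
  have "\<bar>(t *\<^sub>R x) $ i\<bar> \<le> \<delta>" for i
  proof -
    have "\<bar>(t *\<^sub>R x) $ i\<bar> = t * \<bar>x $ i\<bar>" using t by (simp add: abs_mult)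
    also have "\<dots> \<le> t * (norm x + 1)"
      using t component_le_norm_cart[of x i] by (intro mult_left_mono) auto
    also have "\<dots> = \<delta>" using n by (simp add: t_def)
    finally show ?thesis .
  qed
  then have "-\<delta> \<le> (t *\<^sub>R x) $ i \<and> (t *\<^sub>R x) $ i \<le> \<delta>" for i
    by (meson abs_le_iff minus_le_iff)
  then show "t *\<^sub>R x \<in> cube \<delta>" by (simp add: cube_def)
qed

lemma cube_mono: "\<delta> \<le> \<epsilon> \<Longrightarrow> cube \<delta> \<subseteq> cube \<epsilon>"
  unfolding cube_def by (intro Collect_mono) (meson neg_le_iff_le order_trans)

lemma is_tangent_cone_subset:
  assumes A: "is_tangent_cone P v A" and B: "is_tangent_cone P v B"
  shows "A \<subseteq> B"
proof
  fix x assume x: "x \<in> A"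
  obtain d where d: "d > 0" "P \<inter> (\<lambda>x. v + x) ` cube d = (\<lambda>x. v + x) ` (A \<inter> cube d)"
    using A by (auto simp: is_tangent_cone_def)
  obtain e where e: "e > 0" "P \<inter> (\<lambda>x. v + x) ` cube e = (\<lambda>x. v + x) ` (B \<inter> cube e)"
    using B by (auto simp: is_tangent_cone_def)
  obtain t where t: "t > 0" "t *\<^sub>R x \<in> cube (min d e)"
    using scale_in_cube[of "min d e" x] d e by auto
  then have c: "t *\<^sub>R x \<in> cube d" "t *\<^sub>R x \<in> cube e"
    using cube_mono[of "min d e" d] cube_mono[of "min d e" e] by auto
  have "t *\<^sub>R x \<in> A"
    using x A t local_arrangement_scale_iff by (auto simp: is_tangent_cone_def)
  then have "v + t *\<^sub>R x \<in> P" using c d(2) by blast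
  then have "v + t *\<^sub>R x \<in> (\<lambda>x. v + x) ` (B \<inter> cube e)" using c e(2) by blast
  then have "t *\<^sub>R x \<in> B" by auto
  then show "x \<in> B"
    using B t local_arrangement_scale_iff by (auto simp: is_tangent_cone_def)
qed

lemma is_tangent_cone_unique:
  "is_tangent_cone P v A \<Longrightarrow> is_tangent_cone P v B \<Longrightarrow> A = B"
  by (meson is_tangent_cone_subset subset_antisym)

lemma is_tangent_cone_pure_box:
  assumes "pure_box B"
  shows "\<exists>A \<delta>. \<delta> > 0 \<and> local_arrangement A \<and>
           (\<forall>x e. x \<in> cube e \<longrightarrow> e \<le> \<delta> \<longrightarrow> (v + x \<in> B \<longleftrightarrow> x \<in> A))"
proof -
  obtain a b where ab: "\<And>i. a $ i < b $ i"
    and B: "B = {x. \<forall>i. a $ i \<le> x $ i \<and> x $ i \<le> b $ i}"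
    using assms by (auto simp: pure_box_def)
  define S where "S = (\<lambda>i. {\<bar>v $ i - a $ i\<bar>, \<bar>v $ i - b $ i\<bar>})"
  define d where "d = Min (insert 1 ((\<Union>i. S i) - {0})) / 2"
  have fin: "finite (insert 1 ((\<Union>i. S i) - {0}))" by (auto simp: S_def)
  have d0: "d > 0" unfolding d_def using fin by (auto simp: S_def)
  have dle: "2 * d \<le> y" if "y \<in> S i" "y \<noteq> 0" for y i
    unfolding d_def using fin that by (auto intro!: Min_le)
  have da: "v $ i = a $ i \<or> \<bar>v $ i - a $ i\<bar> > d" for i
    using dle[of "\<bar>v $ i - a $ i\<bar>" i] d0 by (force simp: S_def)
  have db: "v $ i = b $ i \<or> \<bar>v $ i - b $ i\<bar> > d" for i
    using dle[of "\<bar>v $ i - b $ i\<bar>" i] d0 by (force simp: S_def)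
  define T where "T = {s. sign_function s \<and> v \<in> B \<and>
      (\<forall>i. (v $ i = a $ i \<longrightarrow> s i = 1) \<and> (v $ i = b $ i \<longrightarrow> s i = -1))}"
  define A where "A = \<Union>(orthant ` T)"
  have "local_arrangement A"
    unfolding local_arrangement_def A_def orthants_def
    by (intro exI[of _ "orthant ` T"]) (simp add: T_def image_mono Collect_mono)
  moreover have "v + x \<in> B \<longleftrightarrow> x \<in> A" if x: "x \<in> cube e" "e \<le> d" for x e
  proof -
    have xd: "\<bar>x $ i\<bar> \<le> d" for i
    proof -
      have "-e \<le> x $ i \<and> x $ i \<le> e" using x by (simp add: cube_def)
      then show ?thesis using x(2) by linarith
    qed
    show ?thesis
    proof
      assume vx: "v + x \<in> B"
      then have vx': "a $ i \<le> v $ i + x $ i" "v $ i + x $ i \<le> b $ i" for i by (auto simp: B)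
      have v': "a $ i \<le> v $ i \<and> v $ i \<le> b $ i" for i
        using vx'[of i] da[of i] db[of i] xd[of i] by linarith
      define s where "s i = (if v $ i = a $ i then 1 else if v $ i = b $ i then -1
                             else if x $ i \<ge> 0 then 1 else (-1::real))" for i
      have "v $ i = b $ i \<Longrightarrow> v $ i \<noteq> a $ i" for i
        using ab[of i] by linarith
      then have "s \<in> T" using v' by (simp add: T_def s_def sign_function_def B)
      moreover have "s i * x $ i \<ge> 0" for i
        using vx'[of i] by (simp add: s_def)
      then have "x \<in> orthant s" by (simp add: orthant_def)
      ultimately show "x \<in> A" by (auto simp: A_def)
    next
      assume "x \<in> A"
      then obtain s where s: "s \<in> T" "x \<in> orthant s" by (auto simp: A_def)
      have "a $ i \<le> v $ i + x $ i \<and> v $ i + x $ i \<le> b $ i" for i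
      proof -
        have 1: "a $ i \<le> v $ i" "v $ i \<le> b $ i" "v $ i = a $ i \<longrightarrow> s i = 1"
           "v $ i = b $ i \<longrightarrow> s i = -1" using s(1) by (auto simp: T_def B)
        have 2: "s i * x $ i \<ge> 0" using s(2) by (simp add: orthant_def)
        have 3: "v $ i = a $ i \<longrightarrow> x $ i \<ge> 0" "v $ i = b $ i \<longrightarrow> x $ i \<le> 0"
          using 1 2 by auto
        show ?thesis using 1(1,2) 3 da[of i] db[of i] xd[of i] by linarith
      qed
      then show "v + x \<in> B" by (simp add: B)
    qed
  qed
  ultimately show ?thesis using d0 by blast
qed

lemma ex_is_tangent_cone:
  assumes "pure_orthogonal_polytope P"
  shows "\<exists>A. is_tangent_cone P v A"
proof -
  obtain F where F: "finite F" "\<And>B. B \<in> F \<Longrightarrow> pure_box B" "P = \<Union>F"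
    using assms by (auto simp: pure_orthogonal_polytope_def)
  have "\<forall>B\<in>F. \<exists>A \<delta>. \<delta> > 0 \<and> local_arrangement A \<and>
           (\<forall>x e. x \<in> cube e \<longrightarrow> e \<le> \<delta> \<longrightarrow> (v + x \<in> B \<longleftrightarrow> x \<in> A))"
    using F(2) is_tangent_cone_pure_box by blast
  then obtain A \<delta> where A: "\<And>B. B \<in> F \<Longrightarrow> \<delta> B > 0" "\<And>B. B \<in> F \<Longrightarrow> local_arrangement (A B)"
      "\<And>B x e. B \<in> F \<Longrightarrow> x \<in> cube e \<Longrightarrow> e \<le> \<delta> B \<Longrightarrow> v + x \<in> B \<longleftrightarrow> x \<in> A B"
    by metis
  define d where "d = Min (insert 1 (\<delta> ` F))"
  have d: "d > 0" "\<And>B. B \<in> F \<Longrightarrow> d \<le> \<delta> B"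
    using F(1) A(1) by (auto simp: d_def)
  have "local_arrangement (\<Union>(A ` F))"
  proof -
    have "\<forall>B\<in>F. \<exists>Q\<subseteq>orthants. A B = \<Union>Q" using A(2) by (auto simp: local_arrangement_def)
    then obtain Q where "\<And>B. B \<in> F \<Longrightarrow> Q B \<subseteq> orthants" "\<And>B. B \<in> F \<Longrightarrow> A B = \<Union>(Q B)"
      by metis
    then have "\<Union>(Q ` F) \<subseteq> orthants" "\<Union>(A ` F) = \<Union>(\<Union>(Q ` F))" by auto
    then show ?thesis unfolding local_arrangement_def by blast
  qed
  moreover have "v + x \<in> P \<longleftrightarrow> x \<in> \<Union>(A ` F)" if "x \<in> cube d" for x
    using A(3) d(2) that F(3) by auto
  then have "P \<inter> (\<lambda>x. v + x) ` cube d = (\<lambda>x. v + x) ` (\<Union>(A ` F) \<inter> cube d)"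
    by blast
  ultimately show ?thesis using d(1) unfolding is_tangent_cone_def by blast
qed

lemma tangent_cone:
  assumes "pure_orthogonal_polytope P"
  shows "is_tangent_cone P v (tangent_cone P v)"
  unfolding tangent_cone_def
  using ex_is_tangent_cone[OF assms] is_tangent_cone_unique by (metis theI)

end

theory Submission
  imports Defs
begin

text \<open>The integer grid cuts space into open unit cells, and \<open>P\<close> either contains a cell or misses it.
  So the volume of \<open>P\<close> is the number of cells in \<open>P\<close>. An orthant lies in the tangent cone at an
  integer point \<open>v\<close> iff the cell at the corner \<open>v\<close> in the direction of that orthant lies in \<open>P\<close>;
  each cell has \<open>2\<^sup>d\<close> corners, hence is counted \<open>2\<^sup>d\<close> times by the sum.\<close>

section \<open>Unit cells and the integer grid\<close>

definition cell :: "real ^ 'n \<Rightarrow> (real ^ 'n) set" where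
  "cell w = box w (w + 1)"

lemma mem_cell: "x \<in> cell w \<longleftrightarrow> (\<forall>i. w $ i < x $ i \<and> x $ i < w $ i + 1)"
  by (simp add: cell_def mem_box_cart)

lemma closure_cell: "closure (cell w) = {x. \<forall>i. w $ i \<le> x $ i \<and> x $ i \<le> w $ i + 1}"
proof -
  \<comment> \<open>The centre of the cell shows that the open box is nonempty, as
    \<open>closure_box\<close> requires.\<close>
  have "w + (1/2) *\<^sub>R 1 \<in> box w (w + 1)"
    by (simp add: mem_box_cart)
  then have "closure (cell w) = cbox w (w + 1)"
    unfolding cell_def by (intro closure_box) auto
  then show ?thesis by (auto simp: mem_box_cart)
qed

lemma measure_cell: "measure lebesgue (cell w) = 1"
proof -
  have "(1 :: real ^ 'n) \<bullet> b = 1" if "b \<in> Basis" for b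
    using that by (auto simp: Basis_vec_def inner_axis)
  then show ?thesis
    by (auto simp: cell_def measure_lborel_box_eq inner_add_left intro!: prod.neutral)
qed

lemma cell_lmeasurable: "cell w \<in> lmeasurable"
  by (simp add: cell_def)

lemma integer_points_component:
  assumes "w \<in> integer_points"
  obtains a where "w $ i = of_int a"
  using assms Ints_cases[of "w $ i"] by (auto simp: integer_points_def)

text \<open>Each coordinate of such a corner is forced to be the floor of the corresponding
  coordinate of \<open>x\<close>.\<close>

lemma integer_cell_unique:
  assumes "w \<in> integer_points" "w' \<in> integer_points" "x \<in> cell w" "x \<in> cell w'"
  shows "w = w'"
proof -
  have "w $ i = w' $ i" for i
  proof -
    obtain a b where ab: "w $ i = of_int a" "w' $ i = of_int b"
      using assms(1,2) integer_points_component by metis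
    have "of_int a < x $ i" "x $ i < of_int a + 1" "of_int b < x $ i" "x $ i < of_int b + 1"
      using assms(3,4) by (simp_all add: mem_cell flip: ab)
    then have "a = b" by linarith
    then show ?thesis using ab by simp
  qed
  then show ?thesis by (simp add: vec_eq_iff)
qed

lemma finite_bounded_integer_points:
  fixes S :: "(real ^ 'n) set"
  assumes "bounded S"
  shows "finite (S \<inter> integer_points)"
proof -
  obtain B where B: "\<And>x. x \<in> S \<Longrightarrow> norm x \<le> B"
    using assms by (auto simp: bounded_iff)
  have "S \<inter> integer_points \<subseteq> {v. \<forall>i. v $ i \<in> {k \<in> \<int>. \<bar>k\<bar> \<le> B}}"
    using B component_le_norm_cart by (auto simp: integer_points_def intro: order_trans)
  also have "\<dots> \<subseteq> vec_lambda ` (UNIV \<rightarrow>\<^sub>E {k \<in> \<int>. \<bar>k\<bar> \<le> B})"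
  proof
    fix v :: "real ^ 'n" assume "v \<in> {v. \<forall>i. v $ i \<in> {k \<in> \<int>. \<bar>k\<bar> \<le> B}}"
    then show "v \<in> vec_lambda ` (UNIV \<rightarrow>\<^sub>E {k \<in> \<int>. \<bar>k\<bar> \<le> B})"
      by (intro image_eqI[of _ _ "vec_nth v"]) auto
  qed
  finally show ?thesis
    by (rule finite_subset) (intro finite_imageI finite_PiE finite_abs_int_segment finite)
qed

lemma negligible_grid: "negligible {x :: real ^ 'n. \<exists>i. x $ i \<in> \<int>}"
proof -
  have "negligible (\<Union>(i, k :: int). {x :: real ^ 'n. x $ i = of_int k})"
  proof (rule negligible_countable_Union)
    fix S assume "S \<in> range (\<lambda>(i, k :: int). {x :: real ^ 'n. x $ i = of_int k})"
    then obtain i k where "S = {x. x \<bullet> axis i 1 = of_int k}"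
      by (auto simp: cart_eq_inner_axis)
    then show "negligible S"
      by (simp add: negligible_standard_hyperplane axis_in_Basis_iff)
  qed auto
  then show ?thesis
    by (rule negligible_subset) (auto elim!: Ints_cases)
qed

section \<open>Integral polytopes and the cells they contain\<close>

text \<open>Closedness will pass inclusions from open cells to closed ones; boundedness will make
  the set of integer points in \<open>P\<close> finite.\<close>

lemma integral_polytope_compact:
  assumes "integral_polytope P"
  shows "compact P"
proof -
  obtain F where F: "finite F" "P = \<Union>F"
      "\<And>B. B \<in> F \<Longrightarrow> \<exists>v f. v \<in> integer_points \<and> f face_of cbox 0 1 \<and> B = (\<lambda>x. v + x) ` f"
    using assms unfolding integral_polytope_def by metis
  have "compact B" if B: "B \<in> F" for B
  proof -
    obtain v f where "f face_of cbox 0 1" "B = (\<lambda>x. v + x) ` f"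
      using F(3)[OF B] by blast
    then show ?thesis
      using face_of_imp_compact[OF convex_box(1) compact_cbox] compact_translation by blast
  qed
  then show ?thesis unfolding F(2) using F(1) by (intro compact_Union) auto
qed

text \<open>One point suffices because a proper face of a cube misses its interior: a translated
  face that meets an open cell must be the whole closed cube.\<close>

lemma integral_polytope_cell:
  assumes P: "integral_polytope P" and w: "w \<in> integer_points"
    and x: "x \<in> cell w" "x \<in> P"
  shows "cell w \<subseteq> P"
proof -
  obtain F where F: "P = \<Union>F"
      "\<And>B. B \<in> F \<Longrightarrow> \<exists>v f. v \<in> integer_points \<and> f face_of cbox 0 1 \<and> B = (\<lambda>x. v + x) ` f"
    using P unfolding integral_polytope_def by metis
  then obtain B where "x \<in> B" "B \<in> F" using x(2) by blast
  then obtain v f where B: "x \<in> B" "B \<subseteq> P" "v \<in> integer_points" "f face_of cbox 0 1"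
      "B = (\<lambda>x. v + x) ` f"
    using F(2)[OF \<open>B \<in> F\<close>] F(1) by blast
  have xf: "x - v \<in> f" using B by auto
  then have "x - v \<in> cbox 0 1"
    using face_of_imp_subset[OF B(4)] by blast
  then have 01: "0 \<le> x $ i - v $ i \<and> x $ i - v $ i \<le> 1" for i
    by (simp add: mem_box_cart)
  \<comment> \<open>\<open>x $ i\<close> lies strictly between consecutive integers \<open>a\<close>
    and \<open>a + 1\<close> and also in the closed interval from \<open>b\<close> to
    \<open>b + 1\<close>, so \<open>a = b\<close> and the bounds are strict.\<close>
  have "v $ i < x $ i \<and> x $ i < v $ i + 1" for i
  proof -
    obtain a b where ab: "w $ i = of_int a" "v $ i = of_int b"
      using w B(3) integer_points_component by metis
    have "of_int a < x $ i" "x $ i < of_int a + 1"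
      using x(1) by (simp_all add: mem_cell flip: ab)
    moreover from this have "a = b" using ab(2) 01[of i] by linarith
    ultimately show ?thesis using ab(2) by simp
  qed
  then have xv: "x \<in> cell v" by (simp add: mem_cell)
  then have wv: "w = v" by (rule integer_cell_unique[OF w B(3) x(1)])
  have "x - v \<in> interior (cbox 0 1)"
    using xv by (simp add: mem_cell mem_box_cart less_diff_eq diff_less_eq add.commute)
  then have "f = cbox 0 1"
    using xf face_of_disjoint_interior[OF B(4)] by blast
  moreover have "cell v \<subseteq> (\<lambda>x. v + x) ` cbox 0 1"
  proof
    fix y assume "y \<in> cell v"
    then have "v $ i < y $ i \<and> y $ i < v $ i + 1" for i by (simp add: mem_cell)
    then have "0 \<le> (y - v) $ i \<and> (y - v) $ i \<le> 1" for i
      by (smt (verit) vector_minus_component)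
    then have "y - v \<in> cbox 0 1" by (simp add: mem_box_cart)
    then show "y \<in> (\<lambda>x. v + x) ` cbox 0 1" by (rule rev_image_eqI) simp
  qed
  ultimately have "cell v \<subseteq> B" using B(5) by simp
  then show ?thesis using wv B(2) by simp
qed

text \<open>Cells are recorded by their lower corners, so that they can be matched with integer
  points by a translation.\<close>

definition cells_in :: "(real ^ 'n) set \<Rightarrow> (real ^ 'n) set" where
  "cells_in P = {w \<in> integer_points. cell w \<subseteq> P}"

lemma closure_cell_subset:
  assumes "integral_polytope P" "cell w \<subseteq> P"
  shows "closure (cell w) \<subseteq> P"
  using assms integral_polytope_compact closure_minimal compact_imp_closed by blast

lemma finite_cells_in:
  assumes "integral_polytope P"
  shows "finite (cells_in P)"
proof (rule finite_subset)
  have "w \<in> closure (cell w)" for w :: "real ^ 'n" by (simp add: closure_cell)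
  then show "cells_in P \<subseteq> P \<inter> integer_points"
    using closure_cell_subset[OF assms] by (auto simp: cells_in_def)
  show "finite (P \<inter> integer_points)"
    using assms integral_polytope_compact compact_imp_bounded finite_bounded_integer_points by blast
qed

text \<open>\<open>P\<close> and the disjoint union of its cells differ only by points on the grid,
  which is a null set.\<close>

lemma measure_integral_polytope:
  fixes P :: "(real ^ 'n) set"
  assumes P: "integral_polytope P"
  shows "measure lebesgue P = card (cells_in P)"
proof -
  let ?U = "\<Union>w\<in>cells_in P. cell w"
  have "P - ?U \<subseteq> {x. \<exists>i. x $ i \<in> \<int>}"
  proof
    fix x assume x: "x \<in> P - ?U"
    show "x \<in> {x. \<exists>i. x $ i \<in> \<int>}"
    proof (rule ccontr)
      assume n: "x \<notin> {x. \<exists>i. x $ i \<in> \<int>}"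
      \<comment> \<open>Off the grid, the coordinatewise floor is the corner of an open cell around
        \<open>x\<close>.\<close>
      define w :: "real ^ 'n" where "w = (\<chi> i. of_int \<lfloor>x $ i\<rfloor>)"
      have "of_int \<lfloor>x $ i\<rfloor> \<noteq> x $ i" for i
      proof -
        have "x $ i \<notin> \<int>" using n by blast
        then show ?thesis by (metis Ints_of_int)
      qed
      then have "of_int \<lfloor>x $ i\<rfloor> < x $ i" for i
        by (simp add: order_less_le)
      then have "x \<in> cell w" by (simp add: mem_cell w_def)
      moreover have "w \<in> integer_points" by (simp add: integer_points_def w_def)
      ultimately have "w \<in> cells_in P"
        using integral_polytope_cell[OF P] x by (auto simp: cells_in_def)
      then show False using x \<open>x \<in> cell w\<close> by blast
    qed
  qed
  moreover have "?U - P = {}" by (auto simp: cells_in_def)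
  ultimately have neg: "negligible (?U - P \<union> (P - ?U))"
    by (intro negligible_subset[OF negligible_grid]) blast
  have U: "?U \<in> lmeasurable"
    using finite_cells_in[OF P] cell_lmeasurable by (intro fmeasurable.finite_UN) auto
  have "measure lebesgue P = measure lebesgue ?U"
    by (rule measure_negligible_symdiff[OF U neg])
  also have "\<dots> = (\<Sum>w\<in>cells_in P. measure lebesgue (cell w))"
  proof (rule measure_finite_Union[OF finite_cells_in[OF P]])
    show "disjoint_family_on cell (cells_in P)"
      unfolding disjoint_family_on_def cells_in_def
      using integer_cell_unique by (metis (no_types, lifting) disjoint_iff mem_Collect_eq)
    show "emeasure lebesgue (cell w) \<noteq> \<infinity>" for w :: "real ^ 'n"
      using fmeasurableD2[OF cell_lmeasurable] by simp
  qed (use cell_lmeasurable in blast)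
  finally show ?thesis by (simp add: measure_cell)
qed

section \<open>Orthants and the cells around an integer point\<close>

text \<open>The sign vector of \<open>s\<close> lies in its own orthant; if it also lies in that of
  \<open>t\<close>, no coordinate can have opposite signs.\<close>

lemma inj_on_orthant: "inj_on orthant {s. sign_function s}"
proof (rule inj_onI)
  fix s t :: "'a \<Rightarrow> real"
  assume s: "s \<in> {s. sign_function s}" and t: "t \<in> {s. sign_function s}" and "orthant s = orthant t"
  moreover have "(\<chi> i. s i) \<in> orthant s" by (simp add: orthant_def)
  ultimately have "t i * s i \<ge> 0" for i by (auto simp: orthant_def)
  show "s = t"
  proof
    fix i
    show "s i = t i"
      using \<open>t i * s i \<ge> 0\<close> s t by (auto simp: sign_function_def dest!: spec[of _ i])
  qed
qed

lemma card_sign_functions: "card {s :: 'n::finite \<Rightarrow> real. sign_function s} = 2 ^ CARD('n)"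
proof -
  have "{s :: 'n \<Rightarrow> real. sign_function s} = UNIV \<rightarrow>\<^sub>E {1, -1}"
    by (auto simp: sign_function_def PiE_def)
  then show ?thesis by (simp add: card_funcsetE numeral_2_eq_2)
qed

text \<open>The lower corner of the cell that touches \<open>v\<close> in the direction \<open>s\<close>.\<close>

definition lower_corner :: "('n \<Rightarrow> real) \<Rightarrow> real ^ 'n \<Rightarrow> real ^ 'n" where
  "lower_corner s v = v + (\<chi> i. (s i - 1) / 2)"

text \<open>The shift \<open>(s i - 1) / 2\<close> is 0 or -1, so it preserves integrality both
  ways.\<close>

lemma lower_corner_integer:
  assumes "sign_function s"
  shows "lower_corner s v \<in> integer_points \<longleftrightarrow> v \<in> integer_points"
proof -
  have "lower_corner s v $ i \<in> \<int> \<longleftrightarrow> v $ i \<in> \<int>" for i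
    using assms by (auto simp: lower_corner_def sign_function_def dest!: spec[of _ i])
  then show ?thesis by (simp add: integer_points_def)
qed

lemma orthant_subset_tangent_cone_iff:
  assumes P: "integral_polytope P" and A: "is_tangent_cone P v A"
    and v: "v \<in> integer_points" and s: "sign_function s"
  shows "orthant s \<subseteq> A \<longleftrightarrow> cell (lower_corner s v) \<subseteq> P"
proof
  obtain d where d: "d > 0" "P \<inter> (\<lambda>x. v + x) ` cube d = (\<lambda>x. v + x) ` (A \<inter> cube d)"
    using A by (auto simp: is_tangent_cone_def)
  have dA: "v + x \<in> P \<longleftrightarrow> x \<in> A" if "x \<in> cube d" for x
  proof -
    have "v + x \<in> P \<inter> (\<lambda>x. v + x) ` cube d \<longleftrightarrow> x \<in> A \<inter> cube d"
      unfolding d(2) by auto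
    then show ?thesis using that by auto
  qed
  have s': "s i = 1 \<or> s i = -1" for i using s by (simp add: sign_function_def)
  {
    assume sub: "orthant s \<subseteq> A"
    \<comment> \<open>The test point lies on the diagonal of the orthant: the bound \<open>d\<close>
      keeps it where \<open>P\<close> and \<open>A\<close> agree, the bound 1/2 puts
      \<open>v + x\<close> strictly inside the cell.\<close>
    define t where "t = min d (1/2)"
    define x :: "real ^ 'a" where "x = (\<chi> i. t * s i)"
    have t: "t > 0" "t \<le> d" "t < 1" using d(1) by (auto simp: t_def)
    have x: "x $ i = t \<and> s i = 1 \<or> x $ i = - t \<and> s i = -1" for i
      using s'[of i] by (auto simp: x_def)
    have "0 \<le> s i * x $ i" for i using x[of i] t by auto
    then have "x \<in> orthant s" by (simp add: orthant_def)
    moreover have "- d \<le> x $ i \<and> x $ i \<le> d" for i using x[of i] t by auto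
    then have "x \<in> cube d" by (simp add: cube_def)
    ultimately have "v + x \<in> P" using sub dA by blast
    moreover have "lower_corner s v $ i < (v + x) $ i \<and> (v + x) $ i < lower_corner s v $ i + 1" for i
      using x[of i] t by (auto simp: lower_corner_def)
    then have "v + x \<in> cell (lower_corner s v)" by (simp add: mem_cell)
    ultimately show "cell (lower_corner s v) \<subseteq> P"
      using integral_polytope_cell[OF P] lower_corner_integer[OF s] v by blast
  }
  {
    assume sub: "cell (lower_corner s v) \<subseteq> P"
    show "orthant s \<subseteq> A"
    proof
      fix x assume x: "x \<in> orthant s"
      \<comment> \<open>Scaling does not change membership in \<open>A\<close>. The bound
        \<open>d\<close> gives agreement with \<open>P\<close>, the bound 1 keeps
        \<open>v + t *\<^sub>R x\<close> in the closed cell.\<close>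
      obtain t where t: "t > 0" "t *\<^sub>R x \<in> cube (min d 1)"
        using scale_in_cube[of "min d 1" x] d(1) by auto
      let ?y = "t *\<^sub>R x"
      have y: "?y \<in> cube d" "?y \<in> cube 1" "?y \<in> orthant s"
        using t(2) cube_mono[of "min d 1" d] cube_mono[of "min d 1" 1] x orthant_scale_iff[OF t(1)]
        by auto
      have "lower_corner s v $ i \<le> (v + ?y) $ i \<and> (v + ?y) $ i \<le> lower_corner s v $ i + 1" for i
      proof -
        have "- 1 \<le> ?y $ i" "?y $ i \<le> 1" "0 \<le> s i * ?y $ i"
          using y(2,3) by (auto simp only: cube_def orthant_def mem_Collect_eq)
        then show ?thesis using s'[of i] by (auto simp: lower_corner_def)
      qed
      \<comment> \<open>The orthant is closed, so \<open>v + ?y\<close> may lie on the boundary of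
        the cell; hence the passage to the closure.\<close>
      then have "v + ?y \<in> P"
        using closure_cell_subset[OF P sub] closure_cell by blast
      then show "x \<in> A"
        using dA[OF y(1)] A local_arrangement_scale_iff[OF _ t(1)]
        by (auto simp: is_tangent_cone_def)
    qed
  }
qed

section \<open>Double counting of cells and their corners\<close>

text \<open>Injectivity of \<open>orthant\<close> turns the count of orthants into a count of sign
  functions.\<close>

lemma mu_tangent_cone:
  assumes "integral_polytope P" "is_tangent_cone P v A" "v \<in> integer_points"
  shows "mu A = card {s. sign_function s \<and> lower_corner s v \<in> cells_in P}"
proof -
  have "sign_function s \<and> orthant s \<subseteq> A \<longleftrightarrow> sign_function s \<and> lower_corner s v \<in> cells_in P" for s
    using orthant_subset_tangent_cone_iff[OF assms, of s] lower_corner_integer[of s v] assms(3)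
    by (auto simp: cells_in_def)
  moreover have "{Q \<in> orthants. Q \<subseteq> A} = orthant ` {s. sign_function s \<and> orthant s \<subseteq> A}"
    by (auto simp: orthants_def)
  ultimately have "{Q \<in> orthants. Q \<subseteq> A}
      = orthant ` {s. sign_function s \<and> lower_corner s v \<in> cells_in P}"
    by simp
  moreover have "inj_on orthant {s. sign_function s \<and> lower_corner s v \<in> cells_in P}"
    by (rule inj_on_subset[OF inj_on_orthant]) auto
  ultimately show ?thesis by (simp add: mu_def card_image)
qed

lemma lower_corner_in_closure:
  assumes "sign_function s"
  shows "v \<in> closure (cell (lower_corner s v))"
proof -
  have "lower_corner s v $ i \<le> v $ i \<and> v $ i \<le> lower_corner s v $ i + 1" for i
    using assms by (auto simp: lower_corner_def sign_function_def dest!: spec[of _ i])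
  then show ?thesis by (simp add: closure_cell)
qed

text \<open>Count the pairs \<open>(v, s)\<close> for which the cell at \<open>v\<close> in
  direction \<open>s\<close> lies in \<open>P\<close>. Fixing \<open>v\<close> gives
  \<open>mu (A v)\<close>; fixing \<open>s\<close> gives every cell once, since
  \<open>lower_corner s\<close> is a translation.\<close>

lemma sum_mu_tangent_cone:
  fixes P :: "(real ^ 'n) set"
  assumes P: "integral_polytope P" and A: "\<And>v. is_tangent_cone P v (A v)"
  shows "(\<Sum>v\<in>P \<inter> integer_points. mu (A v)) = 2 ^ CARD('n) * card (cells_in P)"
proof -
  let ?S = "{s :: 'n \<Rightarrow> real. sign_function s}"
  let ?V = "P \<inter> integer_points"
  \<comment> \<open>An infinite set has cardinality 0, so a positive \<open>card\<close> proves
    finiteness.\<close>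
  have finS: "finite ?S"
    by (rule card_ge_0_finite) (simp add: card_sign_functions)
  have finV: "finite ?V"
    using P integral_polytope_compact compact_imp_bounded finite_bounded_integer_points by blast
  have mu: "mu (A v) = card {s \<in> ?S. lower_corner s v \<in> cells_in P}" if "v \<in> ?V" for v
    using mu_tangent_cone[OF P A] that by auto
  have corners: "card {v \<in> ?V. lower_corner s v \<in> cells_in P} = card (cells_in P)" if s: "s \<in> ?S" for s
  proof (rule bij_betw_same_card)
    \<comment> \<open>No corner is lost by restricting to points of \<open>P\<close>: each corner
      lies in the closed cell, which is contained in \<open>P\<close>.\<close>
    have V: "v \<in> ?V" if "lower_corner s v \<in> cells_in P" for v
    proof -
      have w: "lower_corner s v \<in> integer_points" "cell (lower_corner s v) \<subseteq> P"
        using that by (auto simp: cells_in_def)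
      have "sign_function s" using s by simp
      then have "v \<in> closure (cell (lower_corner s v))" "v \<in> integer_points"
        using w(1) by (simp_all add: lower_corner_in_closure lower_corner_integer)
      then show ?thesis using closure_cell_subset[OF P w(2)] by blast
    qed
    show "bij_betw (lower_corner s) {v \<in> ?V. lower_corner s v \<in> cells_in P} (cells_in P)"
    proof (rule bij_betwI[where g = "\<lambda>w. w - (\<chi> i. (s i - 1) / 2)"])
      have inv: "lower_corner s (w - (\<chi> i. (s i - 1) / 2)) = w" for w
        by (simp add: lower_corner_def)
      then show "(\<lambda>w. w - (\<chi> i. (s i - 1) / 2))
          \<in> cells_in P \<rightarrow> {v \<in> ?V. lower_corner s v \<in> cells_in P}"
        using V by (intro Pi_I) simp
      show "lower_corner s (w - (\<chi> i. (s i - 1) / 2)) = w" for w by (rule inv)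
    qed (auto simp: lower_corner_def)
  qed
  have "(\<Sum>v\<in>?V. mu (A v)) = (\<Sum>v\<in>?V. card {s \<in> ?S. lower_corner s v \<in> cells_in P})"
    using mu by (rule sum.cong[OF refl])
  also have "\<dots> = (\<Sum>s\<in>?S. card {v \<in> ?V. lower_corner s v \<in> cells_in P})"
    by (rule sum_multicount_gen[OF finV finS]) blast
  also have "\<dots> = (\<Sum>s\<in>?S. card (cells_in P))"
    using corners by (rule sum.cong[OF refl])
  finally show ?thesis by (simp add: card_sign_functions)
qed

theorem theorem4p7:
  fixes P :: "(real ^ 'n) set"
  assumes "generic_orthotope P"
    and "integral_polytope P"
  shows "measure lebesgue P
    = (1 / 2) ^ CARD('n) * (\<Sum>v\<in>P \<inter> integer_points. real (mu (tangent_cone P v)))"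
proof -
  \<comment> \<open>A generic orthotope is a pure orthogonal polytope, so its tangent cones exist
    and are unique.\<close>
  have "is_tangent_cone P v (tangent_cone P v)" for v
    using assms(1) tangent_cone by (auto simp: generic_orthotope_def)
  then have "(\<Sum>v\<in>P \<inter> integer_points. mu (tangent_cone P v)) = 2 ^ CARD('n) * card (cells_in P)"
    by (rule sum_mu_tangent_cone[OF assms(2)])
  then have "(\<Sum>v\<in>P \<inter> integer_points. real (mu (tangent_cone P v)))
      = 2 ^ CARD('n) * measure lebesgue P"
    by (simp add: measure_integral_polytope[OF assms(2)] flip: of_nat_sum)
  then show ?thesis by (simp add: power_one_over)
qed

end
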